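(* Let $d\in\mathbb N$, $p>2$ and $\varepsilon>0$. There is a constant $C$ independent of $N$ (it may depend on $d,p,\varepsilon$) such that for all $N\in\mathbb N$, $$K_{p,d,N}^p\le C N^{d}K_{p-2,d,N}^{p-2}+C N^{\frac{dp}{2}-d-2+\varepsilon}.$$
   Context: $\mathbb T=\mathbb R/\mathbb Z$ with normalized Lebesgue measure. $S_{d,N}=\{(n_1,\dots,n_d)\in\mathbb Z^d:|n_j|\le N,\ 1\le j\le d\}$ and $|\mathbf n|^2=n_1^2+\cdots+n_d^2$. For $r>0$, $K_{r,d,N}$ is the best (smallest) constant such that for all complex numbers $\{a_{\mathbf n}\}_{\mathbf n\in S_{d,N}}$, $$\left\|\sum_{\mathbf n\in S_{d,N}}a_{\mathbf n}e^{2\pi i(\mathbf n\cdot\mathbf x+|\mathbf n|^2t)}\right\|_{L^r(\mathbb T^{d+1})}\le K_{r,d,N}\left(\sum_{\mathbf n}|a_{\mathbf n}|^2\right)^{1/2},$$ where $\|g\|_{L^r}=(\int|g|^r)^{1/r}$ (also for $0<r<1$). *)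

theory Defs
  imports "HOL-Probability.Probability"
begin

text \<open>The circle \<open>\<real>/\<int>\<close> is represented by its fundamental domain \<open>[0,1)\<close>; points of the
  \<open>d\<close>-dimensional torus are extensional functions on \<open>{..<d}\<close>, so coordinates and
  frequencies are indexed from \<open>0\<close> to \<open>d - 1\<close>.\<close>

definition circle_measure :: "real measure" where
  "circle_measure = restrict_space lborel {0..<1}"

definition torus_measure :: "nat \<Rightarrow> ((nat \<Rightarrow> real) \<times> real) measure" where
  "torus_measure d = (\<Pi>\<^sub>M j\<in>{..<d}. circle_measure) \<Otimes>\<^sub>M circle_measure"

definition freq_box :: "nat \<Rightarrow> nat \<Rightarrow> (nat \<Rightarrow> int) set" where
  "freq_box d N = PiE {..<d} (\<lambda>_. {- int N..int N})"

definition schroedinger_sum ::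
    "nat \<Rightarrow> nat \<Rightarrow> ((nat \<Rightarrow> int) \<Rightarrow> complex) \<Rightarrow> (nat \<Rightarrow> real) \<times> real \<Rightarrow> complex" where
  "schroedinger_sum d N a = (\<lambda>(x, t). \<Sum>n\<in>freq_box d N. a n *
     exp (2 * of_real pi * \<i> *
       of_real ((\<Sum>j<d. of_int (n j) * x j) + of_int (\<Sum>j<d. (n j)\<^sup>2) * t)))"

definition Lr_norm :: "real \<Rightarrow> 'a measure \<Rightarrow> ('a \<Rightarrow> complex) \<Rightarrow> real" where
  "Lr_norm r M g = (\<integral>z. norm (g z) powr r \<partial>M) powr (1 / r)"

definition admissible_const :: "real \<Rightarrow> nat \<Rightarrow> nat \<Rightarrow> real \<Rightarrow> bool" where
  "admissible_const r d N K \<longleftrightarrow>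
     (\<forall>a. Lr_norm r (torus_measure d) (schroedinger_sum d N a)
            \<le> K * sqrt (\<Sum>n\<in>freq_box d N. (norm (a n))\<^sup>2))"

text \<open>The infimum is a minimum for \<open>r > 0\<close>; see \<open>best_const_admissible\<close> and
  \<open>best_const_least\<close> below.\<close>

definition best_const :: "real \<Rightarrow> nat \<Rightarrow> nat \<Rightarrow> real" where
  "best_const r d N = Inf {K. admissible_const r d N K}"

lemma finite_freq_box: "finite (freq_box d N)"
  by (simp add: freq_box_def finite_PiE)

lemma prob_space_circle: "prob_space circle_measure"
  unfolding circle_measure_def
  by (rule prob_spaceI) (simp add: emeasure_restrict_space space_restrict_space)

lemma prob_space_torus: "prob_space (torus_measure d)"
proof -
  interpret C: prob_space circle_measure by (rule prob_space_circle)
  interpret P: product_prob_space "\<lambda>_. circle_measure" "{..<d}" by unfold_locales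
  interpret Q: pair_prob_space "\<Pi>\<^sub>M j\<in>{..<d}. circle_measure" circle_measure
    by unfold_locales
  show ?thesis unfolding torus_measure_def by unfold_locales
qed

lemma measurable_schroedinger_sum:
  "schroedinger_sum d N a \<in> borel_measurable (torus_measure d)"
proof -
  have id: "(\<lambda>x. x) \<in> borel_measurable circle_measure"
    unfolding circle_measure_def by (rule measurable_restrict_space1) simp
  have [measurable]: "snd \<in> borel_measurable (torus_measure d)"
    unfolding torus_measure_def by (rule measurable_compose[OF measurable_snd id])
  have [measurable]: "(\<lambda>z. fst z j) \<in> borel_measurable (torus_measure d)" if "j < d" for j
    unfolding torus_measure_def
    by (rule measurable_compose[OF measurable_compose[OF measurable_fst
      measurable_component_singleton[of j "{..<d}"]] id]) (use that in simp)
  have [measurable]: "(\<lambda>z. \<Sum>j<d. of_int (n j) * fst z j) \<in> borel_measurable (torus_measure d)"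
    for n :: "nat \<Rightarrow> int"
    by (intro borel_measurable_sum borel_measurable_times) auto
  show ?thesis
    unfolding schroedinger_sum_def case_prod_beta by measurable
qed

lemma norm_schroedinger_sum_le:
  "norm (schroedinger_sum d N a z)
     \<le> sqrt (card (freq_box d N)) * sqrt (\<Sum>n\<in>freq_box d N. (norm (a n))\<^sup>2)"
proof -
  have "norm (schroedinger_sum d N a z) \<le> (\<Sum>n\<in>freq_box d N. norm (a n))"
    unfolding schroedinger_sum_def case_prod_beta
    by (rule order.trans[OF norm_sum]) (simp add: norm_mult)
  also have "\<dots> = \<bar>\<Sum>n\<in>freq_box d N. 1 * norm (a n)\<bar>"
    by (simp add: sum_nonneg)
  also have "\<dots> \<le> sqrt ((\<Sum>n\<in>freq_box d N. 1\<^sup>2) * (\<Sum>n\<in>freq_box d N. (norm (a n))\<^sup>2))"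
    by (rule real_le_rsqrt) (use Cauchy_Schwarz_ineq_sum[of "\<lambda>_. 1::real"] in simp)
  finally show ?thesis by (simp add: real_sqrt_mult)
qed

lemma admissible_const_exists:
  assumes "r > 0"
  shows "admissible_const r d N (sqrt (card (freq_box d N)))"
  unfolding admissible_const_def
proof
  fix a :: "(nat \<Rightarrow> int) \<Rightarrow> complex"
  interpret prob_space "torus_measure d" by (rule prob_space_torus)
  note [measurable] = measurable_schroedinger_sum[of d N a]
  define B where
    "B = sqrt (card (freq_box d N)) * sqrt (\<Sum>n\<in>freq_box d N. (norm (a n))\<^sup>2)"
  have B0: "B \<ge> 0" by (simp add: B_def sum_nonneg)
  have le: "norm (schroedinger_sum d N a z) powr r \<le> B powr r" for z
    using norm_schroedinger_sum_le[of d N a z] assms by (intro powr_mono2) (auto simp: B_def)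
  have "integrable (torus_measure d) (\<lambda>z. norm (schroedinger_sum d N a z) powr r)"
    by (rule integrable_const_bound[of _ "B powr r"]) (use le in auto)
  then have "(\<integral>z. norm (schroedinger_sum d N a z) powr r \<partial>torus_measure d) \<le> B powr r"
    by (rule integral_le_const) (use le in auto)
  then have "Lr_norm r (torus_measure d) (schroedinger_sum d N a) \<le> (B powr r) powr (1 / r)"
    unfolding Lr_norm_def using assms by (intro powr_mono2) auto
  also have "\<dots> = B" using assms B0 by (simp add: powr_powr)
  finally show "Lr_norm r (torus_measure d) (schroedinger_sum d N a)
      \<le> sqrt (card (freq_box d N)) * sqrt (\<Sum>n\<in>freq_box d N. (norm (a n))\<^sup>2)"
    by (simp add: B_def)
qed

lemma admissible_const_nonneg:
  assumes "admissible_const r d N K"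
  shows "K \<ge> 0"
proof -
  have "freq_box d N \<noteq> {}"
    by (auto simp: freq_box_def PiE_eq_empty_iff)
  then have pos: "card (freq_box d N) > 0"
    using finite_freq_box by (simp add: card_gt_0_iff)
  have "0 \<le> Lr_norm r (torus_measure d) (schroedinger_sum d N (\<lambda>_. 1))"
    by (simp add: Lr_norm_def)
  also have "\<dots> \<le> K * sqrt (card (freq_box d N))"
    using assms[unfolded admissible_const_def, rule_format, of "\<lambda>_. 1"] by simp
  finally show ?thesis using pos by (simp add: zero_le_mult_iff)
qed

lemma best_const_least:
  assumes "admissible_const r d N K"
  shows "best_const r d N \<le> K"
  unfolding best_const_def
  by (rule cInf_lower) (use assms admissible_const_nonneg in \<open>auto intro!: bdd_belowI\<close>)

lemma best_const_admissible:
  assumes "r > 0"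
  shows "admissible_const r d N (best_const r d N)"
  unfolding admissible_const_def
proof
  fix a :: "(nat \<Rightarrow> int) \<Rightarrow> complex"
  define A where "A = sqrt (\<Sum>n\<in>freq_box d N. (norm (a n))\<^sup>2)"
  define L where "L = Lr_norm r (torus_measure d) (schroedinger_sum d N a)"
  have adm: "L \<le> K * A" if "admissible_const r d N K" for K
    using that by (simp add: admissible_const_def L_def A_def)
  have "A \<ge> 0" by (simp add: A_def sum_nonneg)
  have "L \<le> best_const r d N * A"
  proof (cases "A = 0")
    case True
    then show ?thesis using adm[OF admissible_const_exists[OF assms]] by simp
  next
    case False
    with \<open>A \<ge> 0\<close> have "A > 0" by simp
    then have "L / A \<le> best_const r d N"
      unfolding best_const_def using admissible_const_exists[OF assms] adm
      by (intro cInf_greatest) (auto simp: divide_simps mult.commute)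
    then show ?thesis using \<open>A > 0\<close> by (simp add: divide_simps mult.commute)
  qed
  then show "Lr_norm r (torus_measure d) (schroedinger_sum d N a)
      \<le> best_const r d N * sqrt (\<Sum>n\<in>freq_box d N. (norm (a n))\<^sup>2)"
    by (simp add: L_def A_def)
qed

end

theory Submission
  imports Defs
begin

text \<open>By Cauchy--Schwarz a sum \<open>f\<close> over the frequency box is pointwise bounded by
  \<open>(2N + 1)\<^bsup>d/2\<^esup>\<close> times the \<open>\<ell>\<^sup>2\<close> norm of its coefficients. Inserting this bound into two of the
  \<open>p\<close> factors of \<open>\<integral>\<bar>f\<bar>\<^sup>p = \<integral>\<bar>f\<bar>\<^sup>2 \<bar>f\<bar>\<^bsup>p-2\<^esup>\<close> already gives the claim with \<open>C = 3\<^sup>d\<close>; the second summand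
  on the right-hand side only adds a nonnegative quantity.\<close>

lemma card_freq_box: "card (freq_box d N) = (2 * N + 1) ^ d"
  unfolding freq_box_def by (simp add: card_PiE nat_add_distrib nat_mult_distrib)

text \<open>A bounded measurable function on a probability space is integrable.
  \<open>integral_mono\<close> needs this for the exponents \<open>p\<close> and
  \<open>p - 2\<close>.\<close>

lemma integrable_schroedinger_sum_powr:
  assumes "r \<ge> 0"
  shows "integrable (torus_measure d) (\<lambda>z. norm (schroedinger_sum d N a z) powr r)"
proof -
  interpret prob_space "torus_measure d" by (rule prob_space_torus)
  note [measurable] = measurable_schroedinger_sum[of d N a]
  let ?B = "sqrt (card (freq_box d N)) * sqrt (\<Sum>n\<in>freq_box d N. (norm (a n))\<^sup>2)"
  show ?thesis
    by (rule integrable_const_bound[of _ "?B powr r"])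
      (use assms norm_schroedinger_sum_le[of d N a] in \<open>auto intro!: powr_mono2\<close>)
qed

text \<open>Raising the admissibility of \<open>best_const\<close> to the power \<open>r\<close>
  removes the outer root in \<open>Lr_norm\<close>; no triangle inequality enters, so exponents
  below 1 are covered.\<close>

lemma integral_schroedinger_sum_powr_le:
  assumes "r > 0"
  shows "(\<integral>z. norm (schroedinger_sum d N a z) powr r \<partial>torus_measure d)
    \<le> (best_const r d N * sqrt (\<Sum>n\<in>freq_box d N. (norm (a n))\<^sup>2)) powr r"
proof -
  let ?I = "\<integral>z. norm (schroedinger_sum d N a z) powr r \<partial>torus_measure d"
  have "?I = (?I powr (1 / r)) powr r"
    using assms by (simp add: powr_powr integral_nonneg_AE)
  also have "\<dots> \<le> (best_const r d N * sqrt (\<Sum>n\<in>freq_box d N. (norm (a n))\<^sup>2)) powr r"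
    using best_const_admissible[OF assms, of d N] assms
    by (intro powr_mono2) (auto simp: admissible_const_def Lr_norm_def)
  finally show ?thesis .
qed

lemma best_const_powr_le:
  assumes "p > 2"
  shows "best_const p d N powr p
    \<le> card (freq_box d N) * best_const (p - 2) d N powr (p - 2)"
proof -
  define c where "c = real (card (freq_box d N))"
  define B where "B = best_const (p - 2) d N"
  have B0: "B \<ge> 0"
    unfolding B_def using assms by (intro admissible_const_nonneg[OF best_const_admissible]) simp
  have c0: "c \<ge> 0" by (simp add: c_def)
  \<comment> \<open>The witness is the \<open>p\<close>-th root of the claimed bound, so minimality
    of \<open>best_const\<close> finishes the proof.\<close>
  have "admissible_const p d N ((c * B powr (p - 2)) powr (1 / p))"
    unfolding admissible_const_def
  proof
    fix a :: "(nat \<Rightarrow> int) \<Rightarrow> complex"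
    define A where "A = sqrt (\<Sum>n\<in>freq_box d N. (norm (a n))\<^sup>2)"
    let ?f = "schroedinger_sum d N a"
    have A0: "A \<ge> 0" by (simp add: A_def sum_nonneg)
    \<comment> \<open>At zeros of the sum both sides vanish, since \<open>0 powr s = 0\<close> for
      every \<open>s\<close>.\<close>
    have pow: "x powr p = x\<^sup>2 * x powr (p - 2)" if "x \<ge> 0" for x :: real
      using that assms by (cases "x = 0") (simp_all add: powr_diff)
    have le: "norm (?f z) powr p \<le> c * A\<^sup>2 * norm (?f z) powr (p - 2)" for z
    proof -
      have "(norm (?f z))\<^sup>2 \<le> (sqrt c * A)\<^sup>2"
        using norm_schroedinger_sum_le[of d N a z] unfolding A_def c_def
        by (intro power_mono) auto
      then show ?thesis
        using c0 by (auto simp: pow power_mult_distrib intro!: mult_right_mono)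
    qed
    have "(\<integral>z. norm (?f z) powr p \<partial>torus_measure d)
        \<le> (\<integral>z. c * A\<^sup>2 * norm (?f z) powr (p - 2) \<partial>torus_measure d)"
      using assms le
      by (intro integral_mono integrable_mult_right integrable_schroedinger_sum_powr) auto
    also have "\<dots> = c * A\<^sup>2 * (\<integral>z. norm (?f z) powr (p - 2) \<partial>torus_measure d)"
      by simp
    also have "\<dots> \<le> c * A\<^sup>2 * (B * A) powr (p - 2)"
      using integral_schroedinger_sum_powr_le[of "p - 2" d N a] assms c0
      unfolding A_def B_def by (intro mult_left_mono) auto
    also have "\<dots> = c * B powr (p - 2) * A powr p"
      \<comment> \<open>The two factors \<open>A\<close> from the pointwise bound and the power
        \<open>p - 2\<close> from \<open>B * A\<close> combine to \<open>A powr p\<close>, whose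
        \<open>p\<close>-th root is linear in \<open>A\<close>.\<close>
      using A0 B0 by (simp add: pow powr_mult)
    finally have "Lr_norm p (torus_measure d) ?f
        \<le> (c * B powr (p - 2) * A powr p) powr (1 / p)"
      unfolding Lr_norm_def using assms
      by (intro powr_mono2) (auto intro!: integral_nonneg_AE)
    also have "\<dots> = (c * B powr (p - 2)) powr (1 / p) * A"
      using A0 c0 assms by (simp add: powr_mult powr_powr)
    finally show "Lr_norm p (torus_measure d) ?f
        \<le> (c * B powr (p - 2)) powr (1 / p) * sqrt (\<Sum>n\<in>freq_box d N. (norm (a n))\<^sup>2)"
      by (simp add: A_def)
  qed
  then have "best_const p d N \<le> (c * B powr (p - 2)) powr (1 / p)"
    by (rule best_const_least)
  then have "best_const p d N powr p \<le> ((c * B powr (p - 2)) powr (1 / p)) powr p"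
    using assms
    by (intro powr_mono2 admissible_const_nonneg[OF best_const_admissible]) auto
  also have "\<dots> = c * B powr (p - 2)"
    using c0 assms by (simp add: powr_powr)
  finally show ?thesis by (simp add: c_def B_def)
qed

theorem corollary1p3:
  fixes d :: nat and p \<epsilon> :: real
  assumes "d \<ge> 1" and "p > 2" and "\<epsilon> > 0"
  shows "\<exists>C::real. \<forall>N::nat. N \<ge> 1 \<longrightarrow>
    best_const p d N powr p
      \<le> C * real N ^ d * best_const (p - 2) d N powr (p - 2)
        + C * real N powr (real d * p / 2 - real d - 2 + \<epsilon>)"
\<comment> \<open>The base 3 comes from \<open>2 * N + 1 \<le> 3 * N\<close>, which holds because
  \<open>N \<ge> 1\<close>.\<close>
proof (intro exI[of _ "3 ^ d"] allI impI)
  fix N :: nat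
  assume "N \<ge> 1"
  then have "(2 * N + 1) ^ d \<le> (3 * N) ^ d"
    by (intro power_mono) auto
  then have "real (card (freq_box d N)) \<le> real ((3 * N) ^ d)"
    unfolding card_freq_box by (rule of_nat_mono)
  then have "card (freq_box d N) * best_const (p - 2) d N powr (p - 2)
      \<le> 3 ^ d * real N ^ d * best_const (p - 2) d N powr (p - 2)"
    by (intro mult_right_mono) (auto simp: power_mult_distrib)
  with best_const_powr_le[OF \<open>p > 2\<close>, of d N]
  have "best_const p d N powr p \<le> 3 ^ d * real N ^ d * best_const (p - 2) d N powr (p - 2)"
    by linarith
  then show "best_const p d N powr p
      \<le> 3 ^ d * real N ^ d * best_const (p - 2) d N powr (p - 2)
        + 3 ^ d * real N powr (real d * p / 2 - real d - 2 + \<epsilon>)"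
    by (rule add_increasing2[rotated]) simp
qed

end
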